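(* Let $G$ be a finite group and let $H$ be a nontrivial proper normal subgroup of $G$. Then the normal subgroup based power graph $\Gamma_H(G)$ is planar if and only if $|H|\in\{2,3\}$ and $G/H\cong \mathbb{Z}_2\times\mathbb{Z}_2\times\cdots\times\mathbb{Z}_2$ (a finite direct product of one or more copies of $\mathbb{Z}_2$).
   Context: For a finite group $G$ with identity $e$ and a normal subgroup $H$ of $G$, the normal subgroup based power graph $\Gamma_H(G)$ is the simple undirected graph with vertex set $V(\Gamma_H(G))=(G\setminus H)\cup\{e\}$, in which two distinct vertices $x,y$ are adjacent if and only if $xH=y^mH$ or $yH=x^nH$ for some $m,n\in\mathbb{N}$. Here $\mathbb{N}$ denotes the positive integers. Nontrivial proper means $H\neq\{e\}$ and $H\neq G$. A graph is planar if it can be drawn in the plane so that no two edges intersect (except at common endpoints). *)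

theory Defs
  imports "HOL-Analysis.Analysis" "HOL-Algebra.Algebra"
begin

text \<open>
  A finite simple graph is given by its vertex set \<open>V\<close> and its edge set \<open>E\<close>, where an edge is
  the two-element set of its end points.  In a plane drawing, \<open>p\<close> places the vertices and \<open>\<gamma> e\<close> is
  the curve that represents \<open>e\<close>, in either direction.  The next-to-last condition keeps a curve away
  from the vertices that are not its end points.
\<close>

definition plane_drawing ::
  "'a set \<Rightarrow> 'a set set \<Rightarrow> ('a \<Rightarrow> complex) \<Rightarrow> ('a set \<Rightarrow> real \<Rightarrow> complex) \<Rightarrow> bool" where
  "plane_drawing V E p \<gamma> \<longleftrightarrow>
     inj_on p V \<and>
     (\<forall>e\<in>E. arc (\<gamma> e) \<and> {pathstart (\<gamma> e), pathfinish (\<gamma> e)} = p ` e) \<and>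
     (\<forall>e\<in>E. path_image (\<gamma> e) \<inter> p ` V = p ` e) \<and>
     (\<forall>e\<in>E. \<forall>f\<in>E. e \<noteq> f \<longrightarrow> path_image (\<gamma> e) \<inter> path_image (\<gamma> f) = p ` (e \<inter> f))"

definition planar_graph :: "'a set \<Rightarrow> 'a set set \<Rightarrow> bool" where
  "planar_graph V E \<longleftrightarrow> (\<exists>p \<gamma>. plane_drawing V E p \<gamma>)"

definition npg_verts :: "('a, 'b) monoid_scheme \<Rightarrow> 'a set \<Rightarrow> 'a set" where
  "npg_verts G H = (carrier G - H) \<union> {\<one>\<^bsub>G\<^esub>}"

definition npg_adj :: "('a, 'b) monoid_scheme \<Rightarrow> 'a set \<Rightarrow> 'a \<Rightarrow> 'a \<Rightarrow> bool" where
  "npg_adj G H x y \<longleftrightarrow> x \<noteq> y \<and>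
     ((\<exists>m::nat. m > 0 \<and> x <#\<^bsub>G\<^esub> H = (y [^]\<^bsub>G\<^esub> m) <#\<^bsub>G\<^esub> H) \<or>
      (\<exists>n::nat. n > 0 \<and> y <#\<^bsub>G\<^esub> H = (x [^]\<^bsub>G\<^esub> n) <#\<^bsub>G\<^esub> H))"

definition npg_edges :: "('a, 'b) monoid_scheme \<Rightarrow> 'a set \<Rightarrow> 'a set set" where
  "npg_edges G H = {{x, y} | x y. x \<in> npg_verts G H \<and> y \<in> npg_verts G H \<and> npg_adj G H x y}"

end

theory Submission
  imports Defs "HOL-Complex_Analysis.Winding_Numbers"
begin

text \<open>
  The identity of \<open>G\<close> is adjacent to all vertices, and the elements of a coset \<open>x H \<noteq> H\<close> are
  mutually adjacent.  If \<open>|H| \<ge> 4\<close>, one coset and the identity contain a \<open>K\<^sub>5\<close>; if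
  \<open>|H| \<ge> 2\<close> and \<open>x\<^sup>2 \<notin> H\<close>, the disjoint cosets of \<open>x\<close> and \<open>x\<^sup>-\<^sup>1\<close> together with the identity do.
  Otherwise \<open>G / H\<close> has exponent 2 and the graph is a union of copies of \<open>K\<^sub>3\<close> or \<open>K\<^sub>4\<close> glued at the
  identity, which has a straight-line drawing with the copies in disjoint cones.

  For the nonplanarity of \<open>K\<^sub>5\<close>, consider a drawing of \<open>K\<^sub>4\<close>.  A point off the drawing lies inside
  an even number of its four triangles, by additivity of winding numbers, and exactly one of the
  four vertices lies inside the opposite triangle.  A fifth vertex, being joined to each of
  the four by an edge that does not meet the opposite triangle, would lie inside exactly one triangle.
\<close>

subsection \<open>Theta curves\<close>

text \<open>Arcs are kept as point sets, so that edges and paths can be regrouped by set algebra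
  without a choice of parametrization.\<close>

definition arc_between :: "complex set \<Rightarrow> complex \<Rightarrow> complex \<Rightarrow> bool" where
  "arc_between A a b \<longleftrightarrow> (\<exists>g. arc g \<and> pathstart g = a \<and> pathfinish g = b \<and> path_image g = A)"

lemma arc_between_sym: "arc_between A a b \<Longrightarrow> arc_between A b a"
  unfolding arc_between_def by (metis arc_reversepath path_image_reversepath pathfinish_reversepath pathstart_reversepath)

lemma connected_arc_between: "arc_between A a b \<Longrightarrow> connected A"
  unfolding arc_between_def using connected_path_image arc_imp_path by blast

text \<open>An arc is connected and has distinct ends, whereas a finite connected set has at most
  one point. This excludes degenerate arcs in \<open>theta_inner_arc\<close>.\<close>

lemma arc_between_not_ends:
  assumes "arc_between A a b"
  shows "A \<noteq> {a, b}"
proof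
  assume A: "A = {a, b}"
  have "a \<noteq> b"
    using assms arc_distinct_ends unfolding arc_between_def by blast
  then show False
    using A connected_arc_between[OF assms] connected_finite_iff_sing[of A] by auto
qed

lemma arc_between_join:
  assumes "arc_between A a b" "arc_between B b c" "A \<inter> B = {b}"
  shows "arc_between (A \<union> B) a c"
proof -
  obtain g h where g: "arc g" "pathstart g = a" "pathfinish g = b" "path_image g = A"
    and h: "arc h" "pathstart h = b" "pathfinish h = c" "path_image h = B"
    using assms unfolding arc_between_def by blast
  have "arc (g +++ h)"
    using g h assms by (intro arc_join) auto
  then show ?thesis
    unfolding arc_between_def using g h by (intro exI[of _ "g +++ h"]) (auto simp: path_image_join)
qed

text \<open>The winding number of a simple closed curve has norm 1 inside and vanishes outside, so
  being inside becomes an arithmetic condition.\<close>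

lemma inside_iff_winding_number_nonzero:
  assumes "simple_path g" "pathfinish g = pathstart g" "z \<notin> path_image g"
  shows "z \<in> inside (path_image g) \<longleftrightarrow> winding_number g z \<noteq> 0"
proof
  assume "z \<in> inside (path_image g)"
  then show "winding_number g z \<noteq> 0"
    using assms simple_closed_path_norm_winding_number_inside by fastforce
next
  assume "winding_number g z \<noteq> 0"
  then have "z \<notin> outside (path_image g)"
    using assms simple_path_imp_path winding_number_zero_in_outside by blast
  then show "z \<in> inside (path_image g)"
    using assms(3) inside_Un_outside by blast
qed

lemma jordan_inside_outside_arcs:
  assumes "arc_between A a b" "arc_between B a b" "A \<inter> B = {a, b}"
  shows "open (inside (A \<union> B))" "connected (inside (A \<union> B))"
    "frontier (inside (A \<union> B)) = A \<union> B" "inside (A \<union> B) \<noteq> {}"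
proof -
  obtain g h where g: "arc g" "pathstart g = a" "pathfinish g = b" "path_image g = A"
    and h: "arc h" "pathstart h = a" "pathfinish h = b" "path_image h = B"
    using assms unfolding arc_between_def by blast
  have "simple_path (g +++ reversepath h)"
    using g h assms by (intro simple_path_join_loop) (auto simp: arc_reversepath)
  moreover have "path_image (g +++ reversepath h) = A \<union> B"
    using g h by (simp add: path_image_join)
  ultimately show "open (inside (A \<union> B))" "connected (inside (A \<union> B))"
    "frontier (inside (A \<union> B)) = A \<union> B" "inside (A \<union> B) \<noteq> {}"
    using Jordan_inside_outside[of "g +++ reversepath h"] g h by auto
qed

text \<open>The winding number of the loop formed by two of the arcs is the difference of their
  winding numbers, so \<open>z\<close> is inside the loop exactly when these differ.\<close>

lemma theta_parity:
  assumes "arc_between A a b" "arc_between B a b" "arc_between C a b"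
    and "A \<inter> B = {a, b}" "A \<inter> C = {a, b}" "B \<inter> C = {a, b}"
    and "z \<notin> A \<union> B \<union> C"
  shows "z \<in> inside (A \<union> C) \<longleftrightarrow> (z \<in> inside (A \<union> B)) \<noteq> (z \<in> inside (B \<union> C))"
proof -
  obtain f g h where f: "arc f" "pathstart f = a" "pathfinish f = b" "path_image f = A"
    and g: "arc g" "pathstart g = a" "pathfinish g = b" "path_image g = B"
    and h: "arc h" "pathstart h = a" "pathfinish h = b" "path_image h = C"
    using assms unfolding arc_between_def by blast
  have key: "(z \<in> inside (path_image p \<union> path_image q) \<longleftrightarrow> winding_number p z \<noteq> winding_number q z)
    \<and> winding_number p z - winding_number q z \<in> {-1, 0, 1}"
    if "arc p" "pathstart p = a" "pathfinish p = b" "arc q" "pathstart q = a" "pathfinish q = b"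
      "path_image p \<inter> path_image q = {a, b}" "z \<notin> path_image p" "z \<notin> path_image q" for p q
  proof -
    have sp: "simple_path (p +++ reversepath q)"
      using that by (intro simple_path_join_loop) (auto simp: arc_reversepath)
    have im: "path_image (p +++ reversepath q) = path_image p \<union> path_image q"
      using that by (simp add: path_image_join)
    have "winding_number (p +++ reversepath q) z = winding_number p z - winding_number q z"
      using that by (subst winding_number_join) (auto simp: arc_imp_path winding_number_reversepath)
    then show ?thesis
      using inside_iff_winding_number_nonzero[OF sp, of z] 
        simple_closed_path_winding_number_cases[OF sp, of z] that im by auto
  qed
  \<comment> \<open>Two differences that are each 1 or -1 add up to 0, 2 or -2, and only 0 is
    possible for the third loop.\<close>
  have "\<And>x y z :: complex. \<lbrakk>x - y \<in> {-1,0,1}; x - z \<in> {-1,0,1}; y - z \<in> {-1,0,1}\<rbrakk>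
    \<Longrightarrow> (x \<noteq> z) = ((x \<noteq> y) \<noteq> (y \<noteq> z))"
    by (auto simp: complex_eq_iff)
  then show ?thesis
    using key[of f g] key[of f h] key[of g h] assms f g h by auto
qed

text \<open>Transfers \<open>split_inside_simple_closed_curve\<close> from parametrized arcs to
  point sets.\<close>

lemma theta_split:
  assumes "arc_between A a b" "arc_between B a b" "arc_between C a b"
    and "A \<inter> B = {a, b}" "A \<inter> C = {a, b}" "B \<inter> C = {a, b}"
    and "C \<inter> inside (A \<union> B) \<noteq> {}"
  shows "inside (A \<union> C) \<inter> inside (B \<union> C) = {}"
    and "inside (A \<union> C) \<union> inside (B \<union> C) \<union> (C - {a, b}) = inside (A \<union> B)"
proof -
  obtain f g h where f: "arc f" "pathstart f = a" "pathfinish f = b" "path_image f = A"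
    and g: "arc g" "pathstart g = a" "pathfinish g = b" "path_image g = B"
    and h: "arc h" "pathstart h = a" "pathfinish h = b" "path_image h = C"
    using assms unfolding arc_between_def by blast
  have "a \<noteq> b"
    using f arc_distinct_ends by blast
  with split_inside_simple_closed_curve[of f a b g h] f g h assms
  show "inside (A \<union> C) \<inter> inside (B \<union> C) = {}"
    and "inside (A \<union> C) \<union> inside (B \<union> C) \<union> (C - {a, b}) = inside (A \<union> B)"
    by (metis arc_imp_simple_path)+
qed

text \<open>Otherwise the three insides are connected open sets off the whole curve. Parity covers
  each by the other two and leaves no point common to all three, so connectedness puts each into one
  of the others. Two insides then coincide, and comparing frontiers shrinks an arc to its
  ends.\<close>

lemma theta_inner_arc:
  assumes "arc_between A a b" "arc_between B a b" "arc_between C a b"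
    and "A \<inter> B = {a, b}" "A \<inter> C = {a, b}" "B \<inter> C = {a, b}"
  shows "A \<inter> inside (B \<union> C) \<noteq> {} \<or> B \<inter> inside (A \<union> C) \<noteq> {} \<or> C \<inter> inside (A \<union> B) \<noteq> {}"
proof (rule ccontr)
  assume contr: "\<not> ?thesis"
  let ?I = "inside (A \<union> B)" and ?J = "inside (A \<union> C)" and ?K = "inside (B \<union> C)"
  have off: "?I \<inter> (A \<union> B \<union> C) = {}" "?J \<inter> (A \<union> B \<union> C) = {}" "?K \<inter> (A \<union> B \<union> C) = {}"
    using contr inside_no_overlap[of "A \<union> B"] inside_no_overlap[of "A \<union> C"] inside_no_overlap[of "B \<union> C"]
    by blast+
  note I = jordan_inside_outside_arcs[OF assms(1,2,4)]
    and J = jordan_inside_outside_arcs[OF assms(1,3,5)]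
    and K = jordan_inside_outside_arcs[OF assms(2,3,6)]
  have par: "z \<in> ?J \<longleftrightarrow> (z \<in> ?I) \<noteq> (z \<in> ?K)" if "z \<notin> A \<union> B \<union> C" for z
    using theta_parity[OF assms that] .
  have dich: "P \<subseteq> Q \<or> P \<subseteq> R"
    if "connected P" "open Q" "open R" "P \<subseteq> Q \<union> R" "P \<inter> Q \<inter> R = {}" for P Q R :: "complex set"
    using connectedD[OF that(1-3)] that by blast
  have notin: "z \<notin> A \<union> B \<union> C" if "z \<in> ?I \<or> z \<in> ?J \<or> z \<in> ?K" for z
    using that off by blast
  have cover: "?I \<subseteq> ?J \<union> ?K" "?J \<subseteq> ?I \<union> ?K" "?K \<subseteq> ?I \<union> ?J"
    using par[OF notin] by blast+
  have dis: "?I \<inter> ?J \<inter> ?K = {}"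
    using par[OF notin] by blast
  have I': "?I \<subseteq> ?J \<or> ?I \<subseteq> ?K"
    using cover dis by (intro dich I J K) auto
  have J': "?J \<subseteq> ?I \<or> ?J \<subseteq> ?K"
    using cover dis by (intro dich I J K) auto
  have K': "?K \<subseteq> ?I \<or> ?K \<subseteq> ?J"
    using cover dis by (intro dich I J K) auto
  \<comment> \<open>If the inside that contains \<open>?I\<close> were in turn contained in the
    third one, the nonempty \<open>?I\<close> would lie in all three.\<close>
  have "?I = ?J \<or> ?I = ?K"
    using I' J' K' dis I(4) J(4) K(4) by blast
  then have "A \<union> B = A \<union> C \<or> A \<union> B = B \<union> C"
    using I(3) J(3) K(3) by metis
  then have "B = {a, b} \<or> A = {a, b}"
    using assms(4-6) by blast
  then show False
    using arc_between_not_ends assms(1,2) by blast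
qed

text \<open>The half-open arc is the image of \<open>{0<..1}\<close>. It serves to follow an edge
  that ends on a triangle without touching the triangle.\<close>

lemma connected_arc_minus_start:
  assumes "arc_between A a b"
  shows "connected (A - {a})"
proof -
  obtain g where g: "arc g" "pathstart g = a" "pathfinish g = b" "path_image g = A"
    using assms unfolding arc_between_def by blast
  have inj: "inj_on g {0..1}" and cont: "continuous_on {0..1} g"
    using g by (auto simp: arc_def path_def)
  have "A - {a} = g ` {0..1} - g ` {0}"
    using g by (auto simp: path_image_def pathstart_def)
  also have "\<dots> = g ` ({0..1} - {0})"
    using inj by (intro inj_on_image_set_diff[symmetric]) auto
  also have "{0..1} - {0} = {0<..1::real}"
    by auto
  finally have "A - {a} = g ` {0<..1}" .
  moreover have "connected (g ` {0<..1})"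
    by (intro connected_continuous_image continuous_on_subset[OF cont]) auto
  ultimately show ?thesis
    by simp
qed

lemma connected_subset_inside:
  assumes "connected T" "T \<inter> S = {}" "x \<in> T" "x \<in> inside S"
  shows "T \<subseteq> inside S"
proof
  fix y assume "y \<in> T"
  then have "connected_component (- S) x y"
    using assms unfolding connected_component_def by (intro exI[of _ T]) auto
  then show "y \<in> inside S"
    using assms(4) inside_same_component by blast
qed

subsection \<open>Drawings of complete graphs\<close>

text \<open>Vertices are identified with the points that represent them. \<open>edge_sym\<close>
  carries no membership condition, so edges can be reversed freely in set identities.\<close>

locale complete_drawing =
  fixes V :: "complex set" and S :: "complex \<Rightarrow> complex \<Rightarrow> complex set"
  assumes edge_arc: "\<lbrakk>x \<in> V; y \<in> V; x \<noteq> y\<rbrakk> \<Longrightarrow> arc_between (S x y) x y"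
    and edge_sym: "S x y = S y x"
    and edge_vertices: "\<lbrakk>x \<in> V; y \<in> V; x \<noteq> y; z \<in> V\<rbrakk> \<Longrightarrow> z \<in> S x y \<longleftrightarrow> z = x \<or> z = y"
    and edge_inter: "\<lbrakk>x \<in> V; y \<in> V; x \<noteq> y; u \<in> V; v \<in> V; u \<noteq> v; {x, y} \<noteq> {u, v}\<rbrakk>
      \<Longrightarrow> S x y \<inter> S u v = {x, y} \<inter> {u, v}"
begin

definition tri :: "complex \<Rightarrow> complex \<Rightarrow> complex \<Rightarrow> complex set" where
  "tri x y z = S x y \<union> S x z \<union> S y z"

lemma tri_swap12: "tri x y z = tri y x z" and tri_swap23: "tri x y z = tri x z y"
  unfolding tri_def using edge_sym by blast+

lemma edge_disjoint:
  assumes "{w, x, y, z} \<subseteq> V" "distinct [w, x, y, z]"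
  shows "S w x \<inter> S y z = {}"
  using edge_inter[of w x y z] assms by auto

lemma edge_adjacent:
  assumes "{x, y, z} \<subseteq> V" "distinct [x, y, z]"
  shows "S x y \<inter> S x z = {x}"
  using edge_inter[of x y x z] assms by (auto simp: doubleton_eq_iff)

lemma two_edges_arc:
  assumes "{x, y, z} \<subseteq> V" "distinct [x, y, z]"
  shows "arc_between (S x z \<union> S y z) x y"
  using arc_between_join[of "S x z" x z "S z y" y] edge_arc[of x z] edge_arc[of z y]
    edge_adjacent[of z x y] edge_sym assms by auto

lemma edge_inter_two_edges:
  assumes "{x, y, z} \<subseteq> V" "distinct [x, y, z]"
  shows "S x y \<inter> (S x z \<union> S y z) = {x, y}"
  using edge_adjacent[of x y z] edge_adjacent[of y x z] edge_sym[of x y] assms by auto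

lemma two_edges_inter:
  assumes "{w, x, y, z} \<subseteq> V" "distinct [w, x, y, z]"
  shows "(S x z \<union> S y z) \<inter> (S x w \<union> S y w) = {x, y}"
proof -
  have "S x z \<inter> S x w = {x}" "S x z \<inter> S y w = {}" "S y z \<inter> S x w = {}" "S y z \<inter> S y w = {y}"
    using edge_adjacent[of x z w] edge_adjacent[of y z w] edge_disjoint[of x z y w]
      edge_disjoint[of y z x w] assms by auto
  then show ?thesis by blast
qed

text \<open>Without the edge from \<open>a\<close> to \<open>b\<close>, the drawing of
  \<open>K\<^sub>4\<close> is a theta curve with ends \<open>c\<close> and \<open>d\<close>; the
  claims are the hypotheses of the theta lemmas.\<close>

lemma quadrilateral_theta:
  assumes "{a, b, c, d} \<subseteq> V" "distinct [a, b, c, d]"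
  shows "arc_between (S c d) c d" "arc_between (S c a \<union> S d a) c d" "arc_between (S c b \<union> S d b) c d"
    and "S c d \<inter> (S c a \<union> S d a) = {c, d}" "S c d \<inter> (S c b \<union> S d b) = {c, d}"
    and "(S c a \<union> S d a) \<inter> (S c b \<union> S d b) = {c, d}"
  by (rule edge_arc two_edges_arc edge_inter_two_edges two_edges_inter; use assms in auto)+

lemma tri_eq: "S x y \<union> (S x z \<union> S y z) = tri x y z"
  by (auto simp: tri_def)

text \<open>The vertex inside its opposite triangle is the one that is not on the unbounded face of
  the drawing of \<open>K\<^sub>4\<close>.\<close>

lemma inside_opposite_triangle_unique:
  assumes "{w, x, y, z} \<subseteq> V" "distinct [w, x, y, z]" and "w \<in> inside (tri x y z)"
  shows "z \<notin> inside (tri x y w)"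
proof
  assume "z \<in> inside (tri x y w)"
  let ?A = "S x y" and ?B = "S x z \<union> S y z" and ?C = "S x w \<union> S y w"
  have "w \<in> ?C" "z \<in> tri x y z"
    using edge_vertices assms by (auto simp: tri_def)
  \<comment> \<open>The path through \<open>w\<close> splits the inside of the triangle
    \<open>x y z\<close>. The inside of \<open>x y w\<close> is one of the parts, so
    \<open>z\<close> would be inside a curve on which it lies.\<close>
  moreover have "?C \<inter> inside (?A \<union> ?B) \<noteq> {}"
    using assms(3) \<open>w \<in> ?C\<close> unfolding tri_eq by blast
  then have "inside (?A \<union> ?C) \<subseteq> inside (?A \<union> ?B)"
    using theta_split(2)[OF quadrilateral_theta[of z w x y]] assms(1,2) by fastforce
  then have "z \<in> inside (tri x y z)"
    using \<open>z \<in> inside (tri x y w)\<close> unfolding tri_eq by blast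
  ultimately show False
    using inside_no_overlap[of "tri x y z"] by blast
qed

text \<open>Removing the edge \<open>w z\<close> or the edge \<open>x y\<close> leaves a theta curve
  with an inner arc. If that arc is a path of two edges, its middle vertex is the required one.
  Otherwise both edges are chords running inside the quadrilateral; one chord splits it, and the
  other, being disjoint from the first, has an end inside a triangle.\<close>

lemma inside_opposite_triangle_exists:
  assumes "{w, x, y, z} \<subseteq> V" "distinct [w, x, y, z]"
  shows "w \<in> inside (tri x y z) \<or> x \<in> inside (tri w y z) \<or> y \<in> inside (tri w x z) \<or> z \<in> inside (tri w x y)"
proof -
  have two: "a \<in> inside (tri b c d) \<or> b \<in> inside (tri a c d) \<or>
      S c d \<inter> inside ((S c a \<union> S d a) \<union> (S c b \<union> S d b)) \<noteq> {}"
    if "{a, b, c, d} \<subseteq> V" "distinct [a, b, c, d]" for a b c d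
  proof -
    let ?A = "S c d" and ?B = "S c a \<union> S d a" and ?C = "S c b \<union> S d b"
    have *: "arc_between ?A c d" "arc_between ?B c d" "arc_between ?C c d"
      "?A \<inter> ?B = {c, d}" "?A \<inter> ?C = {c, d}" "?B \<inter> ?C = {c, d}"
      using quadrilateral_theta that by metis+
    have mem: "a \<in> ?B - {c, d}" "b \<in> ?C - {c, d}"
      using that edge_vertices by auto
    \<comment> \<open>An inner arc lies inside with all its points except its ends, in particular
      with its middle vertex.\<close>
    have "b \<in> inside (?A \<union> ?B)" if "?C \<inter> inside (?A \<union> ?B) \<noteq> {}"
      using theta_split(2)[OF * that] mem by blast
    moreover have "a \<in> inside (?A \<union> ?C)" if "?B \<inter> inside (?A \<union> ?C) \<noteq> {}"
      using theta_split(2)[OF *(1,3,2,5,4) _ that] *(6) mem by (simp add: Int_commute) blast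
    moreover have "tri b c d = ?A \<union> ?C" "tri a c d = ?A \<union> ?B"
      unfolding tri_def using edge_sym by blast+
    ultimately show ?thesis
      using theta_inner_arc[OF *] by auto
  qed
  \<comment> \<open>The edge from \<open>a\<close> to \<open>b\<close> meets the triangle only in
    \<open>b\<close>, so it can be followed from \<open>q\<close> to \<open>a\<close> within the
    inside.\<close>
  have in_tri: "a \<in> inside (tri b c d)"
    if "{a, b, c, d} \<subseteq> V" "distinct [a, b, c, d]" "q \<in> S a b" "q \<in> inside (tri b c d)" for a b c d q
  proof -
    have "S a b \<inter> S b c = {b}" "S a b \<inter> S b d = {b}" "S a b \<inter> S c d = {}"
      using edge_adjacent[of b a c] edge_adjacent[of b a d] edge_disjoint[of a b c d] edge_sym that by auto
    then have "(S a b - {b}) \<inter> tri b c d = {}"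
      by (auto simp: tri_def)
    moreover have "b \<in> tri b c d"
      using edge_vertices that by (auto simp: tri_def)
    then have "q \<noteq> b"
      using that inside_no_overlap[of "tri b c d"] by blast
    moreover have "connected (S a b - {b})"
      using connected_arc_minus_start[of "S a b" b a] arc_between_sym edge_arc[of a b] that by auto
    ultimately have "S a b - {b} \<subseteq> inside (tri b c d)"
      using that by (intro connected_subset_inside[where x = q]) auto
    then show ?thesis
      using edge_vertices[of a b a] that by auto
  qed
  let ?A = "S x y" and ?B = "S x z \<union> S y z" and ?C = "S x w \<union> S y w"
  have quad: "(S w x \<union> S z x) \<union> (S w y \<union> S z y) = ?B \<union> ?C"
    using edge_sym by blast
  consider "w \<in> inside (tri z x y)" | "z \<in> inside (tri w x y)"
    | "x \<in> inside (tri y w z)" | "y \<in> inside (tri x w z)"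
    | "?A \<inter> inside (?B \<union> ?C) \<noteq> {}" "S w z \<inter> inside (?B \<union> ?C) \<noteq> {}"
    using two[of w z x y] two[of x y w z] assms unfolding quad by (auto simp: Un_commute)
  then show ?thesis
  proof cases
    case 5
    have "{z, w, x, y} \<subseteq> V" "distinct [z, w, x, y]"
      using assms by auto
    note th = quadrilateral_theta[OF this]
    \<comment> \<open>The chord \<open>x y\<close> cuts the inside of the quadrilateral into the
      insides of two triangles, and the point \<open>q\<close> of the other chord lies in one of
      them.\<close>
    from theta_split(2)[OF th(2,3,1,6) _ _ 5(1)] th(4,5)
    have "inside (?B \<union> ?A) \<union> inside (?C \<union> ?A) \<union> (?A - {x, y}) = inside (?B \<union> ?C)"
      by (simp add: Int_commute)
    moreover from 5 obtain q where q: "q \<in> S w z" "q \<in> inside (?B \<union> ?C)"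
      by blast
    moreover have "q \<notin> ?A"
      using q edge_disjoint[of w z x y] assms by auto
    moreover have "?B \<union> ?A = tri z x y" "?C \<union> ?A = tri w x y"
      unfolding tri_def using edge_sym by blast+
    ultimately have "q \<in> inside (tri z x y) \<or> q \<in> inside (tri w x y)"
      by (metis DiffD1 UnE)
    then have "w \<in> inside (tri z x y) \<or> z \<in> inside (tri w x y)"
      using in_tri[of w z x y q] in_tri[of z w x y q] q assms edge_sym[of w z] by auto
    then show ?thesis
      by (metis tri_swap12 tri_swap23)
  qed (metis tri_swap12 tri_swap23)+
qed

text \<open>This is \<open>theta_parity\<close> with the chord \<open>c d\<close> as the arc shared
  by the two triangles.\<close>

lemma quadrilateral_parity:
  assumes "{a, b, c, d} \<subseteq> V" "distinct [a, b, c, d]" "p \<notin> tri a c d \<union> tri b c d"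
  shows "p \<in> inside ((S c a \<union> S d a) \<union> (S c b \<union> S d b)) \<longleftrightarrow>
    (p \<in> inside (tri a c d)) \<noteq> (p \<in> inside (tri b c d))"
proof -
  let ?A = "S c d" and ?B = "S c a \<union> S d a" and ?C = "S c b \<union> S d b"
  have tri: "tri a c d = ?B \<union> ?A" "tri b c d = ?A \<union> ?C"
    unfolding tri_def using edge_sym by blast+
  note q = quadrilateral_theta[OF assms(1,2)]
  show ?thesis
    unfolding tri by (rule theta_parity[OF q(2,1,3) _ q(6,5)]) (use q(4) assms(3) tri in auto)
qed

text \<open>The quadrilateral through \<open>x\<close>, \<open>z\<close>, \<open>y\<close>, \<open>w\<close> has two chords; comparing the two
  resulting parities eliminates its interior.\<close>

lemma triangles_parity:
  assumes "{w, x, y, z} \<subseteq> V" "distinct [w, x, y, z]"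
    and "p \<notin> tri x y z \<union> tri w y z \<union> tri w x z \<union> tri w x y"
  shows "((p \<in> inside (tri x y z)) \<noteq> (p \<in> inside (tri w x y))) \<longleftrightarrow>
    ((p \<in> inside (tri w x z)) \<noteq> (p \<in> inside (tri w y z)))"
proof -
  have eqs: "tri z x y = tri x y z" "tri x z w = tri w x z" "tri y z w = tri w y z"
    by (metis tri_swap12 tri_swap23)+
  have "(S x z \<union> S y z) \<union> (S x w \<union> S y w) = (S z x \<union> S w x) \<union> (S z y \<union> S w y)"
    using edge_sym by blast
  then show ?thesis
    using quadrilateral_parity[of z w x y p] quadrilateral_parity[of x y z w p] assms
    unfolding eqs by auto
qed

text \<open>The edge from \<open>u\<close> to \<open>v\<close> shares no end with the sides of the
  triangle, hence is a connected set that misses it.\<close>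

lemma inside_triangle_transfer:
  assumes "{u, v, x, y, z} \<subseteq> V" "distinct [u, v, x, y, z]" "u \<in> inside (tri x y z)"
  shows "v \<in> inside (tri x y z)"
proof -
  have "S u v \<inter> S x y = {}" "S u v \<inter> S x z = {}" "S u v \<inter> S y z = {}"
    using edge_disjoint assms by auto
  then have "S u v \<inter> tri x y z = {}"
    by (auto simp: tri_def)
  moreover have "connected (S u v)"
    using connected_arc_between edge_arc[of u v] assms by simp
  ultimately have "S u v \<subseteq> inside (tri x y z)"
    using edge_vertices[of u v u] assms by (intro connected_subset_inside[where x = u]) auto
  then show ?thesis
    using edge_vertices[of u v v] assms by auto
qed

lemma no_five_vertices:
  assumes "{v, w, x, y, z} \<subseteq> V" "distinct [v, w, x, y, z]"
  shows False
proof -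
  \<comment> \<open>Stating the condition as an equality of sets lets \<open>a\<close> be any of the
    four vertices, with the others in any order.\<close>
  have no: "a \<notin> inside (tri b c d)" if "{a, b, c, d} = {w, x, y, z}" for a b c d
  proof
    assume a: "a \<in> inside (tri b c d)"
    have abcd: "{v, a, b, c, d} \<subseteq> V"
      using that assms by simp
    have "card {w, x, y, z} = 4" "v \<notin> {w, x, y, z}"
      using assms by auto
    then have "card (set [a, b, c, d]) = length [a, b, c, d]" "v \<notin> {a, b, c, d}"
      using that by auto
    then have dist: "distinct [v, a, b, c, d]"
      using card_distinct by fastforce
    have "v \<in> inside (tri b c d)"
      using inside_triangle_transfer[of a v b c d] a abcd dist by auto
    moreover have "v \<notin> tri b c d \<union> tri a c d \<union> tri a b d \<union> tri a b c"
      using abcd dist edge_vertices by (auto simp: tri_def)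
    \<comment> \<open>By parity \<open>v\<close> is inside a second triangle. The vertex opposite to
      it follows \<open>v\<close> inside, and then two vertices lie inside their opposite
      triangles.\<close>
    ultimately consider "v \<in> inside (tri a b c)" | "v \<in> inside (tri a b d)" | "v \<in> inside (tri a c d)"
      using triangles_parity[of a b c d v] abcd dist by auto
    then show False
    proof cases
      case 1
      then have "d \<in> inside (tri b c a)"
        using inside_triangle_transfer[of v d a b c] abcd dist tri_swap12 tri_swap23 by auto
      then show False
        using inside_opposite_triangle_unique[of a b c d] a abcd dist by auto
    next
      case 2
      then have "c \<in> inside (tri b d a)"
        using inside_triangle_transfer[of v c a b d] abcd dist tri_swap12 tri_swap23 by auto
      then show False
        using inside_opposite_triangle_unique[of a b d c] a tri_swap23[of b c d] abcd dist by auto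
    next
      case 3
      then have "b \<in> inside (tri c d a)"
        using inside_triangle_transfer[of v b a c d] abcd dist tri_swap12 tri_swap23 by auto
      then show False
        using inside_opposite_triangle_unique[of a c d b] a tri_swap23 tri_swap12 abcd dist by auto
    qed
  qed
  then show False
    using inside_opposite_triangle_exists[of w x y z] assms by auto
qed

end

section \<open>Nonplanarity of graphs that contain a complete graph on five vertices\<close>

lemma complete_graph_5_not_planar:
  assumes "planar_graph V E" "U \<subseteq> V" "card U \<ge> 5"
    and "\<And>x y. \<lbrakk>x \<in> U; y \<in> U; x \<noteq> y\<rbrakk> \<Longrightarrow> {x, y} \<in> E"
  shows False
proof -
  obtain p \<gamma> where pd: "plane_drawing V E p \<gamma>"
    using assms(1) unfolding planar_graph_def by blast
  then have inj_V: "inj_on p V"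
    and arc: "\<And>e. e \<in> E \<Longrightarrow> arc (\<gamma> e)"
    and ends: "\<And>e. e \<in> E \<Longrightarrow> {pathstart (\<gamma> e), pathfinish (\<gamma> e)} = p ` e"
    and verts: "\<And>e. e \<in> E \<Longrightarrow> path_image (\<gamma> e) \<inter> p ` V = p ` e"
    and cross: "\<And>e f. \<lbrakk>e \<in> E; f \<in> E; e \<noteq> f\<rbrakk> \<Longrightarrow> path_image (\<gamma> e) \<inter> path_image (\<gamma> f) = p ` (e \<inter> f)"
    unfolding plane_drawing_def by simp_all
  have inj: "inj_on p U"
    using inj_V assms(2) by (rule inj_on_subset)
  \<comment> \<open>The locale speaks about points of the plane; \<open>inv_into\<close> recovers
    the vertices that they represent.\<close>
  define S where "S u v = path_image (\<gamma> {inv_into U p u, inv_into U p v})" for u v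
  have S: "S (p x) (p y) = path_image (\<gamma> {x, y})" if "x \<in> U" "y \<in> U" for x y
    using that inj by (simp add: S_def)
  interpret complete_drawing "p ` U" S
  proof
    fix a b assume "a \<in> p ` U" "b \<in> p ` U" "a \<noteq> b"
    then obtain x y where xy: "x \<in> U" "y \<in> U" "x \<noteq> y" "a = p x" "b = p y"
      by auto
    define g where "g = \<gamma> {x, y}"
    have "arc g" "{pathstart g, pathfinish g} = {a, b}" "path_image g = S a b"
      using arc ends assms(4)[of x y] xy S unfolding g_def by auto
    \<comment> \<open>The curve of an edge may run in either direction, so it is reversed where
      necessary.\<close>
    then have "(pathstart g = a \<and> pathfinish g = b) \<or> (pathstart (reversepath g) = a \<and> pathfinish (reversepath g) = b)"
      by (auto simp: doubleton_eq_iff)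
    then show "arc_between (S a b) a b"
      unfolding arc_between_def using \<open>arc g\<close> \<open>path_image g = S a b\<close>
      by (metis arc_reversepath path_image_reversepath)
  next
    show "S a b = S b a" for a b
      by (simp add: S_def insert_commute)
  next
    fix a b c assume "a \<in> p ` U" "b \<in> p ` U" "a \<noteq> b" "c \<in> p ` U"
    then obtain x y z where xy: "x \<in> U" "y \<in> U" "x \<noteq> y" "a = p x" "b = p y" "z \<in> U" "c = p z"
      by auto
    have "S a b \<inter> p ` V = {a, b}"
      using verts assms(4)[of x y] xy S by auto
    moreover have "c \<in> p ` V"
      using xy assms(2) by auto
    ultimately show "c \<in> S a b \<longleftrightarrow> c = a \<or> c = b"
      by blast
  next
    fix a b c d assume *: "a \<in> p ` U" "b \<in> p ` U" "a \<noteq> b" "c \<in> p ` U" "d \<in> p ` U" "c \<noteq> d" "{a, b} \<noteq> {c, d}"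
    then obtain x y z w where xy: "x \<in> U" "y \<in> U" "a = p x" "b = p y" "z \<in> U" "c = p z" "w \<in> U" "d = p w"
      by auto
    have "{x, y} \<noteq> {z, w}" "{x, y} \<in> E" "{z, w} \<in> E"
      using * xy assms(4) by (auto simp: doubleton_eq_iff)
    then have "path_image (\<gamma> {x, y}) \<inter> path_image (\<gamma> {z, w}) = p ` ({x, y} \<inter> {z, w})"
      by (rule cross[rotated 2])
    also have "\<dots> = p ` {x, y} \<inter> p ` {z, w}"
      by (rule inj_on_image_Int[OF inj]) (use xy in auto)
    finally show "S a b \<inter> S c d = {a, b} \<inter> {c, d}"
      using S xy by simp
  qed
  obtain T where "T \<subseteq> p ` U" "card T = 5" "finite T"
    using obtain_subset_with_card_n[of 5 "p ` U"] assms(3) card_image[OF inj] by metis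
  then obtain vs where "set vs = T" "distinct vs" "length vs = 5"
    by (metis finite_distinct_list distinct_card)
  moreover then obtain v w x y z where "vs = [v, w, x, y, z]"
    by (auto simp: length_Suc_conv numeral_eq_Suc)
  ultimately show False
    using no_five_vertices[of v w x y z] \<open>T \<subseteq> p ` U\<close> by auto
qed

subsection \<open>Straight-line drawings\<close>

text \<open>By \<open>covered\<close>, a vertex on a foreign segment is an intersection of that
  segment with an edge at the vertex. Thus \<open>cross\<close> also keeps edges away from vertices
  that are not their ends.\<close>

lemma planar_graph_straight_lines:
  fixes p :: "'a \<Rightarrow> complex"
  assumes inj: "inj_on p V"
    and edges: "\<And>e. e \<in> E \<Longrightarrow> card e = 2 \<and> e \<subseteq> V"
    and covered: "V \<subseteq> \<Union>E"
    and cross: "\<And>e f. \<lbrakk>e \<in> E; f \<in> E; e \<noteq> f\<rbrakk> \<Longrightarrow> convex hull (p ` e) \<inter> convex hull (p ` f) \<subseteq> p ` (e \<inter> f)"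
  shows "planar_graph V E"
proof -
  have "\<exists>g. arc g \<and> {pathstart g, pathfinish g} = p ` e \<and> path_image g = convex hull (p ` e)" if e: "e \<in> E" for e
  proof -
    obtain x y where "e = {x, y}" "x \<in> V" "y \<in> V" "x \<noteq> y"
      using edges[OF e] by (auto simp: card_2_iff)
    then show ?thesis
      using inj by (intro exI[of _ "linepath (p x) (p y)"]) (auto simp: segment_convex_hull inj_on_eq_iff)
  qed
  then obtain \<gamma> where \<gamma>: "\<And>e. e \<in> E \<Longrightarrow> arc (\<gamma> e) \<and> {pathstart (\<gamma> e), pathfinish (\<gamma> e)} = p ` e
      \<and> path_image (\<gamma> e) = convex hull (p ` e)"
    by metis
  have hull: "p ` e \<subseteq> convex hull (p ` e)" for e
    by (rule hull_subset)
  have "path_image (\<gamma> e) \<inter> p ` V = p ` e" if e: "e \<in> E" for e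
  proof
    show "path_image (\<gamma> e) \<inter> p ` V \<subseteq> p ` e"
    proof clarify
      fix v assume v: "p v \<in> path_image (\<gamma> e)" "v \<in> V"
      then obtain f where f: "f \<in> E" "v \<in> f"
        using covered by blast
      show "p v \<in> p ` e"
      proof (cases "e = f")
        case True
        then show ?thesis
          using f by blast
      next
        case False
        moreover have "p v \<in> convex hull (p ` f)" "p v \<in> convex hull (p ` e)"
          using hull[of f] f v \<gamma>[OF e] by auto
        ultimately show ?thesis
          using cross[OF e f(1)] by blast
      qed
    qed
    show "p ` e \<subseteq> path_image (\<gamma> e) \<inter> p ` V"
      using edges[OF e] \<gamma>[OF e] hull[of e] by auto
  qed
  moreover have "path_image (\<gamma> e) \<inter> path_image (\<gamma> f) = p ` (e \<inter> f)" if "e \<in> E" "f \<in> E" "e \<noteq> f" for e f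
    using \<gamma>[OF that(1)] \<gamma>[OF that(2)] cross[OF that] hull[of e] hull[of f] by auto
  ultimately have "plane_drawing V E p \<gamma>"
    unfolding plane_drawing_def using inj \<gamma> by simp
  then show ?thesis
    unfolding planar_graph_def by blast
qed

text \<open>The drawing is pulled back along \<open>f\<close>; injectivity keeps distinct edges
  distinct and makes images commute with intersections.\<close>

lemma planar_graph_embed:
  assumes "planar_graph W F" "inj_on f V" "f ` V \<subseteq> W" "\<And>e. e \<in> E \<Longrightarrow> e \<subseteq> V \<and> f ` e \<in> F"
  shows "planar_graph V E"
proof -
  obtain p \<gamma> where pd: "plane_drawing W F p \<gamma>"
    using assms(1) unfolding planar_graph_def by blast
  then have inj: "inj_on p W"
    and arc: "\<And>e. e \<in> F \<Longrightarrow> arc (\<gamma> e)"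
    and ends: "\<And>e. e \<in> F \<Longrightarrow> {pathstart (\<gamma> e), pathfinish (\<gamma> e)} = p ` e"
    and verts: "\<And>e. e \<in> F \<Longrightarrow> path_image (\<gamma> e) \<inter> p ` W = p ` e"
    and cross: "\<And>e f. \<lbrakk>e \<in> F; f \<in> F; e \<noteq> f\<rbrakk> \<Longrightarrow> path_image (\<gamma> e) \<inter> path_image (\<gamma> f) = p ` (e \<inter> f)"
    unfolding plane_drawing_def by simp_all
  have "plane_drawing V E (p \<circ> f) (\<lambda>e. \<gamma> (f ` e))"
    unfolding plane_drawing_def
  proof (intro conjI ballI impI)
    show "inj_on (p \<circ> f) V"
      using assms(2,3) inj by (meson comp_inj_on inj_on_subset)
  next
    fix e assume e: "e \<in> E"
    then have F: "f ` e \<in> F" and sub: "e \<subseteq> V"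
      using assms(4) by blast+
    show "arc (\<gamma> (f ` e))" "{pathstart (\<gamma> (f ` e)), pathfinish (\<gamma> (f ` e))} = (p \<circ> f) ` e"
      using arc[OF F] ends[OF F] by (auto simp: image_comp)
    have "(p \<circ> f) ` V \<subseteq> p ` W" "(p \<circ> f) ` e \<subseteq> (p \<circ> f) ` V"
      using assms(3) sub by auto
    moreover have "path_image (\<gamma> (f ` e)) \<inter> p ` W = (p \<circ> f) ` e"
      using verts[OF F] by (simp add: image_comp)
    ultimately show "path_image (\<gamma> (f ` e)) \<inter> (p \<circ> f) ` V = (p \<circ> f) ` e"
      by blast
  next
    fix e e' assume e: "e \<in> E" "e' \<in> E" "e \<noteq> e'"
    then have "f ` e \<noteq> f ` e'"
      using assms(2,4) inj_on_image_eq_iff[of f V e e'] by blast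
    moreover have "f ` (e \<inter> e') = f ` e \<inter> f ` e'"
      using assms(2,4) e inj_on_image_Int[of f V e e'] by blast
    ultimately have "path_image (\<gamma> (f ` e)) \<inter> path_image (\<gamma> (f ` e')) = p ` (f ` (e \<inter> e'))"
      using cross[of "f ` e" "f ` e'"] assms(4) e by metis
    then show "path_image (\<gamma> (f ` e)) \<inter> path_image (\<gamma> (f ` e')) = (p \<circ> f) ` (e \<inter> e')"
      by (simp only: image_comp)
  qed
  then show ?thesis
    unfolding planar_graph_def by blast
qed

subsection \<open>Windmill graphs\<close>

text \<open>A windmill of copies of \<open>K\<^sub>4\<close>: the hub \<open>None\<close> is common to all copies, and
  \<open>Some (j, i)\<close> with \<open>i \<in> {0, 1, 2}\<close> are the other vertices of the copy \<open>j\<close>.  The copy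
  \<open>j\<close> is drawn inside the cone of slopes between \<open>3 j\<close> and \<open>3 j + 2\<close>.\<close>

definition windmill_point :: "(nat \<times> nat) option \<Rightarrow> complex" where
  "windmill_point w = (case w of None \<Rightarrow> 0 | Some (j, i) \<Rightarrow>
    (if i = 0 then Complex 1 (3 * j) else if i = 1 then Complex 1 (3 * j + 2)
     else Complex (1 / 2) ((3 * j + 1) / 2)))"

definition windmill_verts :: "(nat \<times> nat) option set" where
  "windmill_verts = insert None (Some ` (UNIV \<times> {0, 1, 2}))"

definition windmill_block :: "nat \<Rightarrow> (nat \<times> nat) option set set" where
  "windmill_block j = {{None, Some (j, 0)}, {None, Some (j, 1)}, {None, Some (j, 2)},
    {Some (j, 0), Some (j, 1)}, {Some (j, 0), Some (j, 2)}, {Some (j, 1), Some (j, 2)}}"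

text \<open>Every block is the image of the block with index 0 under a shear; in the coordinates
  \<open>Re z\<close> and \<open>slant j z\<close> the block \<open>j\<close> no longer depends on \<open>j\<close>.\<close>

definition slant :: "nat \<Rightarrow> complex \<Rightarrow> real" where
  "slant j z = Im z - 3 * real j * Re z"

text \<open>In the coordinates \<open>(Re z, slant j z)\<close> the block is the triangle with
  corners (0, 0), (1, 0), (1, 2) together with the interior point (1/2, 1/2).\<close>

lemma windmill_point_iff:
  "z = windmill_point None \<longleftrightarrow> Re z = 0 \<and> slant j z = 0"
  "z = windmill_point (Some (j, 0)) \<longleftrightarrow> Re z = 1 \<and> slant j z = 0"
  "z = windmill_point (Some (j, Suc 0)) \<longleftrightarrow> Re z = 1 \<and> slant j z = 2"
  "z = windmill_point (Some (j, 2)) \<longleftrightarrow> Re z = 1 / 2 \<and> slant j z = 1 / 2"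
  by (auto simp: windmill_point_def slant_def complex_eq_iff field_simps)

text \<open>Both coordinates are linear, so a point of a segment has them interpolated with the same
  parameter.\<close>

lemma mem_hull_two:
  assumes z: "z \<in> convex hull (p ` {a, b})"
  obtains t where "0 \<le> t" "t \<le> 1" "Re z = (1 - t) * Re (p a) + t * Re (p b)"
    "slant j z = (1 - t) * slant j (p a) + t * slant j (p b)"
proof -
  have "z \<in> closed_segment (p a) (p b)"
    using assms by (simp add: segment_convex_hull)
  then obtain t where t: "0 \<le> t" "t \<le> 1" "z = (1 - t) *\<^sub>R p a + t *\<^sub>R p b"
    by (auto simp: closed_segment_def)
  have "Re z = (1 - t) * Re (p a) + t * Re (p b)"
    "slant j z = (1 - t) * slant j (p a) + t * slant j (p b)"
    unfolding t(3) by (simp_all add: slant_def algebra_simps)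
  with t that show thesis
    by blast
qed

lemma windmill_coordinates:
  "Re (windmill_point None) = 0" "slant j (windmill_point None) = 0"
  "Re (windmill_point (Some (j, 0))) = 1" "slant j (windmill_point (Some (j, 0))) = 0"
  "Re (windmill_point (Some (j, Suc 0))) = 1" "slant j (windmill_point (Some (j, Suc 0))) = 2"
  "Re (windmill_point (Some (j, 2))) = 1 / 2" "slant j (windmill_point (Some (j, 2))) = 1 / 2"
  using windmill_point_iff by blast+

text \<open>Line equations and ranges of the six segments. One direction suffices, since
  intersections only have to be bounded from above.\<close>

lemma windmill_hulls:
  "z \<in> convex hull (windmill_point ` {None, Some (j, 0)}) \<Longrightarrow>
    slant j z = 0 \<and> 0 \<le> Re z \<and> Re z \<le> 1"
  "z \<in> convex hull (windmill_point ` {None, Some (j, 1)}) \<Longrightarrow>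
    slant j z = 2 * Re z \<and> 0 \<le> Re z \<and> Re z \<le> 1"
  "z \<in> convex hull (windmill_point ` {None, Some (j, 2)}) \<Longrightarrow>
    slant j z = Re z \<and> 0 \<le> Re z \<and> Re z \<le> 1 / 2"
  "z \<in> convex hull (windmill_point ` {Some (j, 0), Some (j, 1)}) \<Longrightarrow>
    Re z = 1 \<and> 0 \<le> slant j z \<and> slant j z \<le> 2"
  "z \<in> convex hull (windmill_point ` {Some (j, 0), Some (j, 2)}) \<Longrightarrow>
    slant j z = 1 - Re z \<and> 1 / 2 \<le> Re z \<and> Re z \<le> 1"
  "z \<in> convex hull (windmill_point ` {Some (j, 1), Some (j, 2)}) \<Longrightarrow>
    slant j z = 3 * Re z - 1 \<and> 1 / 2 \<le> Re z \<and> Re z \<le> 1"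
  by (erule mem_hull_two[where j = j], simp add: windmill_coordinates)+

text \<open>For each pair of segments the two line equations and ranges either contradict each other
  or leave just the common vertex.\<close>

lemma windmill_cross_same_block:
  assumes "e \<in> windmill_block j" "f \<in> windmill_block j" "e \<noteq> f"
  shows "convex hull (windmill_point ` e) \<inter> convex hull (windmill_point ` f) \<subseteq> windmill_point ` (e \<inter> f)"
proof clarify
  fix z assume "z \<in> convex hull (windmill_point ` e)" "z \<in> convex hull (windmill_point ` f)"
  then show "z \<in> windmill_point ` (e \<inter> f)"
    using assms unfolding windmill_block_def insert_iff empty_iff simp_thms
    by - (elim disjE; hypsubst; (drule windmill_hulls)+; simp add: windmill_point_iff[where j = j])
qed

text \<open>The last conjunct says that only edges at the hub reach the apex of the cone.\<close>

lemma windmill_cone: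
  assumes "e \<in> windmill_block j" "z \<in> convex hull (windmill_point ` e)"
  shows "0 \<le> slant j z \<and> slant j z \<le> 2 * Re z \<and> (Re z = 0 \<longrightarrow> None \<in> e)"
  using assms unfolding windmill_block_def insert_iff empty_iff simp_thms
  by - (elim disjE; hypsubst; drule windmill_hulls; simp)

lemma windmill_cross_different_blocks:
  assumes "e \<in> windmill_block j" "f \<in> windmill_block k" "j < k"
    "z \<in> convex hull (windmill_point ` e)" "z \<in> convex hull (windmill_point ` f)"
  shows "z \<in> windmill_point ` (e \<inter> f)"
proof -
  note e = windmill_cone[OF assms(1,4)] and f = windmill_cone[OF assms(2,5)]
  \<comment> \<open>The bounding slopes \<open>3 * j + 2\<close> and \<open>3 * k\<close> of the two
    cones differ by at least 1, and \<open>z\<close> lies below the first line and above the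
    second.\<close>
  have "1 * Re z \<le> (3 * real k - 3 * real j - 2) * Re z"
    using assms(3) e by (intro mult_right_mono) auto
  also have "\<dots> \<le> 0"
    using e f by (simp add: slant_def algebra_simps)
  finally have "Re z = 0"
    using e by linarith
  then have "slant j z = 0"
    using e by linarith
  with \<open>Re z = 0\<close> have "z = windmill_point None" "None \<in> e \<inter> f"
    using windmill_point_iff(1)[of z j] e f by auto
  then show ?thesis
    by blast
qed

lemma planar_windmill: "planar_graph windmill_verts (\<Union>j. windmill_block j)"
proof (rule planar_graph_straight_lines)
  \<comment> \<open>Residues modulo 3 separate the vertices with index 0 from those with index 1,
    all of which have real part 1.\<close>
  have parity: "3 * real j \<noteq> 2 + 3 * real k" for j k :: nat
  proof -
    have "3 * j \<noteq> 2 + 3 * k"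
      by presburger
    then have "real (3 * j) \<noteq> real (2 + 3 * k)"
      by (simp only: of_nat_eq_iff not_False_eq_True)
    then show ?thesis
      by simp
  qed
  show "inj_on windmill_point windmill_verts"
    using parity parity[THEN not_sym]
    by (auto simp: inj_on_def windmill_verts_def windmill_point_def complex_eq_iff)
  show "card e = 2 \<and> e \<subseteq> windmill_verts"
    if "e \<in> (\<Union>j. windmill_block j)" for e
    using that by (auto simp: windmill_block_def windmill_verts_def)
  show "windmill_verts \<subseteq> \<Union>(\<Union>j. windmill_block j)"
    by (auto simp: windmill_block_def windmill_verts_def)
  show "convex hull (windmill_point ` e) \<inter> convex hull (windmill_point ` f) \<subseteq> windmill_point ` (e \<inter> f)"
    if e: "e \<in> (\<Union>j. windmill_block j)" and f: "f \<in> (\<Union>j. windmill_block j)" and "e \<noteq> f" for e f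
  proof -
    obtain j k where jk: "e \<in> windmill_block j" "f \<in> windmill_block k"
      using e f by blast
    consider "j = k" | "j < k" | "k < j"
      by linarith
    then show ?thesis
    proof cases
      case 1
      then show ?thesis
        using windmill_cross_same_block jk \<open>e \<noteq> f\<close> by blast
    next
      case 2
      then show ?thesis
        using windmill_cross_different_blocks[OF jk] by blast
    next
      case 3
      then show ?thesis
        using windmill_cross_different_blocks[OF jk(2,1)] by blast
    qed
  qed
qed

subsection \<open>Groups of exponent 2\<close>

text \<open>Makes powers of \<open>x\<close> compatible with addition in
  \<open>integer_mod_group 2\<close>.\<close>

lemma (in group) int_pow_mod_2:
  fixes m :: int
  assumes "x \<in> carrier G" "x \<otimes> x = \<one>"
  shows "x [^] (m mod 2) = x [^] m"
proof -
  have "x [^] (2 * (m div 2)) = (x [^] (2 :: int)) [^] (m div 2)"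
    using assms by (simp add: int_pow_pow)
  moreover have "x [^] (2 :: int) = x \<otimes> x"
    using assms int_pow_mult[of x 1 1] by simp
  ultimately have "x [^] (2 * (m div 2)) = \<one>"
    using assms by simp
  moreover have "x [^] m = x [^] (2 * (m div 2)) \<otimes> x [^] (m mod 2)"
    using assms int_pow_mult[of x "2 * (m div 2)" "m mod 2"] by simp
  ultimately show ?thesis
    using assms by simp
qed

text \<open>Every element is its own inverse, and inversion reverses products.\<close>

lemma (in group) exponent_2_comm:
  assumes "\<And>x. x \<in> carrier G \<Longrightarrow> x \<otimes> x = \<one>"
  shows "comm_group G"
proof (rule group_comm_groupI)
  fix x y assume xy: "x \<in> carrier G" "y \<in> carrier G"
  have "inv z = z" if "z \<in> carrier G" for z
    using that assms inv_equality by blast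
  then show "x \<otimes> y = y \<otimes> x"
    using xy inv_mult_group[of x y] by simp
qed

text \<open>The analogue of extending an independent family over the field with two elements:
  \<open>x\<close> generates the new factor.\<close>

lemma (in comm_group) extend_mon_from_product:
  assumes exp: "\<And>x. x \<in> carrier G \<Longrightarrow> x \<otimes> x = \<one>"
    and h: "h \<in> mon (product_group {..<k} (\<lambda>_. integer_mod_group 2)) G"
    and x: "x \<in> carrier G" "x \<notin> h ` carrier (product_group {..<k} (\<lambda>_. integer_mod_group 2))"
  shows "(\<lambda>f. h (restrict f {..<k}) \<otimes> x [^] f k) \<in> mon (product_group {..<Suc k} (\<lambda>_. integer_mod_group 2)) G"
    (is "?h' \<in> mon ?P' G")
proof -
  let ?P = "product_group {..<k} (\<lambda>_. integer_mod_group 2)"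
  interpret P: group ?P by simp
  interpret P': group ?P' by simp
  interpret h: group_hom ?P G h
    using h by unfold_locales (simp add: mon_def)
  have res: "restrict f {..<k} \<in> carrier ?P" if "f \<in> carrier ?P'" for f
    using that by (auto simp: PiE_iff)
  have hc: "h (restrict f {..<k}) \<in> carrier G" if "f \<in> carrier ?P'" for f
    using h.hom_closed[OF res[OF that]] .
  have hom: "?h' \<in> hom ?P' G"
  proof (rule homI)
    fix f assume "f \<in> carrier ?P'"
    then show "?h' f \<in> carrier G"
      using hc x by simp
  next
    fix f g assume fg: "f \<in> carrier ?P'" "g \<in> carrier ?P'"
    have "restrict (f \<otimes>\<^bsub>?P'\<^esub> g) {..<k} = restrict f {..<k} \<otimes>\<^bsub>?P\<^esub> restrict g {..<k}"
      by (auto simp: fun_eq_iff)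
    moreover have "h (restrict f {..<k} \<otimes>\<^bsub>?P\<^esub> restrict g {..<k}) = h (restrict f {..<k}) \<otimes> h (restrict g {..<k})"
      using fg res h.hom_mult by blast
    moreover have "x [^] (f \<otimes>\<^bsub>?P'\<^esub> g) k = x [^] f k \<otimes> x [^] g k"
      using int_pow_mod_2[OF x(1) exp[OF x(1)], of "f k + g k"] x(1) by (simp add: int_pow_mult)
    moreover have "(a \<otimes> b) \<otimes> (c \<otimes> d) = (a \<otimes> c) \<otimes> (b \<otimes> d)"
      if "a \<in> carrier G" "b \<in> carrier G" "c \<in> carrier G" "d \<in> carrier G" for a b c d
      using that by (simp add: m_ac)
    ultimately show "?h' (f \<otimes>\<^bsub>?P'\<^esub> g) = ?h' f \<otimes> ?h' g"
      using hc[OF fg(1)] hc[OF fg(2)] x(1) by (simp only: int_pow_closed)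
  qed
  moreover have "inj_on ?h' (carrier ?P')"
  proof -
    interpret h': group_hom ?P' G ?h'
      using hom by unfold_locales
    have "f = \<one>\<^bsub>?P'\<^esub>" if f: "f \<in> carrier ?P'" "?h' f = \<one>" for f
    proof -
      have "f k \<in> {0..<2}"
        using f(1) by (auto simp: carrier_integer_mod_group PiE_iff)
      then consider "f k = 0" | "f k = 1"
        by fastforce
      then have "f k = 0"
      proof cases
        case 2
        \<comment> \<open>The image under \<open>h\<close> is the inverse of \<open>x\<close>, hence
          \<open>x\<close> itself, although \<open>x\<close> was chosen outside the image.\<close>
        then have "h (restrict f {..<k}) \<otimes> x = \<one>"
          using f x by simp
        then have "h (restrict f {..<k}) = x"
          using exp[OF x(1)] hc[OF f(1)] x(1) r_cancel by metis
        then show ?thesis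
          using x(2) res[OF f(1)] by blast
      qed
      then have "h (restrict f {..<k}) = h \<one>\<^bsub>?P\<^esub>"
        using f hc[OF f(1)] h.hom_one by simp
      then have "restrict f {..<k} = \<one>\<^bsub>?P\<^esub>"
        using h res[OF f(1)] P.one_closed by (metis (no_types, lifting) inj_onD mon_def mem_Collect_eq)
      then have "f i = 0" if "i < Suc k" for i
        using that \<open>f k = 0\<close> by (cases "i = k") (auto simp: fun_eq_iff less_Suc_eq split: if_splits)
      then show ?thesis
        using f(1) by (auto simp: fun_eq_iff PiE_iff extensional_def)
    qed
    then have "kernel ?P' G ?h' = {\<one>\<^bsub>?P'\<^esub>}"
      unfolding kernel_def using h'.hom_one P'.one_closed by blast
    then show ?thesis
      by (simp only: h'.inj_iff_trivial_ker)
  qed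
  ultimately show ?thesis
    by (simp add: mon_def)
qed

text \<open>A monomorphism from the largest power of the group of order 2 that embeds is onto, since
  otherwise it could be extended. The value \<open>k = 0\<close> covers the trivial group.\<close>

lemma (in group) exponent_2_iff_iso_product:
  assumes "finite (carrier G)"
  shows "(\<forall>x\<in>carrier G. x \<otimes> x = \<one>) \<longleftrightarrow> (\<exists>k::nat. G \<cong> product_group {..<k} (\<lambda>_. integer_mod_group 2))"
proof
  assume exp: "\<forall>x\<in>carrier G. x \<otimes> x = \<one>"
  then interpret comm_group G
    using exponent_2_comm by blast
  define P where "P k = product_group {..<k::nat} (\<lambda>_. integer_mod_group 2)" for k
  define K where "K = {k. mon (P k) G \<noteq> {}}"
  have "k \<le> card (carrier G)" if k: "k \<in> K" for k
  proof -
    obtain h where "h \<in> mon (P k) G"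
      using k unfolding K_def by blast
    then have h: "h \<in> hom (P k) G" "inj_on h (carrier (P k))"
      by (auto simp: mon_def)
    have "card (carrier (P k)) \<le> card (carrier G)"
      using h assms by (intro card_inj_on_le[of h]) (auto simp: hom_def)
    \<comment> \<open>The exponents are bounded because the embedded product has
      \<open>2 ^ k\<close> elements.\<close>
    then have "2 ^ k \<le> card (carrier G)"
      by (simp add: P_def card_PiE carrier_integer_mod_group)
    then show ?thesis
      using less_exp[of k] by linarith
  qed
  then have fin: "finite K"
    using finite_nat_set_iff_bounded_le by blast
  have "(\<lambda>_. \<one>) \<in> mon (P 0) G"
    by (auto simp: mon_def hom_def P_def)
  then have "0 \<in> K"
    by (auto simp: K_def)
  define k where "k = Max K"
  have "k \<in> K"
    unfolding k_def using fin \<open>0 \<in> K\<close> by (intro Max_in) auto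
  have "Suc k \<notin> K"
    using Max_ge[OF fin, of "Suc k"] by (auto simp: k_def)
  obtain h where h: "h \<in> mon (P k) G"
    using \<open>k \<in> K\<close> unfolding K_def by blast
  have "h ` carrier (P k) = carrier G"
  proof (rule ccontr)
    assume "h ` carrier (P k) \<noteq> carrier G"
    moreover have "h ` carrier (P k) \<subseteq> carrier G"
      using h by (auto simp: mon_def hom_def)
    ultimately obtain x where "x \<in> carrier G" "x \<notin> h ` carrier (P k)"
      by blast
    then show False
      using extend_mon_from_product[of h k x] exp h \<open>Suc k \<notin> K\<close> unfolding K_def P_def by blast
  qed
  then have "P k \<cong> G"
    using h unfolding is_iso_def iso_def mon_def bij_betw_def by blast
  then have "G \<cong> P k"
    by (rule group.iso_sym[rotated]) (simp add: P_def)
  then show "\<exists>k::nat. G \<cong> product_group {..<k} (\<lambda>_. integer_mod_group 2)"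
    by (auto simp: P_def)
next
  assume "\<exists>k::nat. G \<cong> product_group {..<k} (\<lambda>_. integer_mod_group 2)"
  then obtain k :: nat and h where h: "h \<in> iso G (product_group {..<k} (\<lambda>_. integer_mod_group 2))"
    by (auto simp: is_iso_def)
  let ?P = "product_group {..<k} (\<lambda>_. integer_mod_group 2)"
  have "h \<in> hom G ?P" "inj_on h (carrier G)"
    using h by (auto simp: iso_def bij_betw_def)
  moreover have "group ?P"
    by simp
  ultimately interpret group_hom G ?P h
    by (intro group_hom.intro group_hom_axioms.intro is_group)
  show "\<forall>x\<in>carrier G. x \<otimes> x = \<one>"
  proof
    fix x assume x: "x \<in> carrier G"
    have "h (x \<otimes> x) = h x \<otimes>\<^bsub>?P\<^esub> h x"
      using x by (intro hom_mult)
    also have "\<dots> = \<one>\<^bsub>?P\<^esub>"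
      by (auto simp: fun_eq_iff)
    also have "\<dots> = h \<one>"
      using hom_one by simp
    finally show "x \<otimes> x = \<one>"
      by (rule inj_onD[OF \<open>inj_on h (carrier G)\<close>]) (use x in auto)
  qed
qed

subsection \<open>The normal subgroup based power graph\<close>

context normal
begin

lemma one_mem: "\<one> \<in> H"
  by (rule subgroup.one_closed[OF is_subgroup])

lemma coset_mem_iff: "\<lbrakk>x \<in> carrier G; y \<in> carrier G\<rbrakk> \<Longrightarrow> y \<in> H #> x \<longleftrightarrow> H #> y = H #> x"
  using repr_independence[of y H x] rcos_self[of y H] is_subgroup by auto

lemma coset_eq_self_iff: "x \<in> carrier G \<Longrightarrow> H #> x = H \<longleftrightarrow> x \<in> H"
  using coset_join1[of H x] coset_join2[of x H] is_subgroup subgroup.subset by blast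

lemma coset_mult: "\<lbrakk>x \<in> carrier G; y \<in> carrier G\<rbrakk> \<Longrightarrow> H #> (x \<otimes> y) = (H #> x) <#> (H #> y)"
  by (simp add: rcos_sum)

text \<open>Adjacency is defined by left cosets and the quotient by right ones; normality identifies
  them. As edges are unordered, one of the two alternatives of \<open>npg_adj\<close> is
  enough.\<close>

lemma npg_edgeI:
  assumes "x \<in> npg_verts G H" "y \<in> npg_verts G H" "x \<noteq> y" "m > 0" "H #> x = H #> (y [^] (m :: nat))"
  shows "{x, y} \<in> npg_edges G H"
proof -
  have "x \<in> carrier G" "y \<in> carrier G"
    using assms by (auto simp: npg_verts_def)
  then have "x <# H = (y [^] m) <# H"
    using assms(5) coset_eq by simp
  then show ?thesis
    using assms unfolding npg_edges_def npg_adj_def by blast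
qed

lemma npg_edgeD:
  assumes "e \<in> npg_edges G H"
  obtains x y m where "e = {x, y}" "x \<in> npg_verts G H" "y \<in> npg_verts G H" "x \<noteq> y"
    "H #> x = H #> (y [^] (m :: nat))"
proof -
  obtain x y where xy: "e = {x, y}" "x \<in> npg_verts G H" "y \<in> npg_verts G H" "npg_adj G H x y"
    using assms unfolding npg_edges_def by blast
  then have "x \<in> carrier G" "y \<in> carrier G"
    by (auto simp: npg_verts_def)
  then show thesis
    using xy that[of x y] that[of y x] coset_eq by (auto simp: npg_adj_def insert_commute)
qed

lemma coset_subset_npg_verts:
  assumes "x \<in> carrier G" "x \<notin> H"
  shows "insert \<one> (H #> x) \<subseteq> npg_verts G H" "\<one> \<notin> H #> x"
proof -
  have notin: "y \<notin> H" if "y \<in> H #> x" for y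
    using that assms coset_mem_iff[of x y] coset_eq_self_iff[of x] coset_eq_self_iff[of y]
      r_coset_subset_G[of H x] subset by auto
  then show "insert \<one> (H #> x) \<subseteq> npg_verts G H"
    using r_coset_subset_G[of H x] assms subset by (auto simp: npg_verts_def)
  show "\<one> \<notin> H #> x"
    using notin one_mem by blast
qed

section \<open>Necessity of the conditions on the subgroup and the quotient\<close>

lemma planar_npg_imp:
  assumes fin: "finite (carrier G)" and "H \<noteq> {\<one>}" "H \<noteq> carrier G"
    and planar: "planar_graph (npg_verts G H) (npg_edges G H)"
  shows "card H \<in> {2, 3}" and "\<And>x. x \<in> carrier G \<Longrightarrow> x \<otimes> x \<in> H"
proof -
  have finH: "finite H"
    using fin subset finite_subset by blast
  have two: "card H \<ge> 2"
  proof (rule ccontr)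
    assume "\<not> ?thesis"
    then have "card H = 1"
      using finH one_mem card_0_eq[OF finH] by fastforce
    then show False
      using assms(2) one_mem by (metis card_1_singletonE singletonD)
  qed
  have card: "card (H #> x) = card H" if "x \<in> carrier G" for x
    using card_rcosets_equal[of "H #> x" H] rcosetsI[of H x] that subset by simp
  have K5: False
    if "U \<subseteq> npg_verts G H" "card U \<ge> 5"
      "\<And>x y. \<lbrakk>x \<in> U; y \<in> U; x \<noteq> y; x \<noteq> \<one>; y \<noteq> \<one>\<rbrakk> \<Longrightarrow> {x, y} \<in> npg_edges G H" for U
  proof (rule complete_graph_5_not_planar[OF planar that(1,2)])
    fix x y assume xy: "x \<in> U" "y \<in> U" "x \<noteq> y"
    have one: "{\<one>, z} \<in> npg_edges G H" if "z \<in> npg_verts G H" "z \<noteq> \<one>" for z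
    proof (rule npg_edgeI)
      \<comment> \<open>The exponent \<open>order G\<close> sends every element to the identity, so
        the identity is adjacent to all other vertices.\<close>
      show "order G > 0"
        using fin order_gt_0_iff_finite by blast
      show "H #> \<one> = H #> (z [^] order G)"
        using that pow_order_eq_1[of z] subset one_mem by (auto simp: npg_verts_def)
    qed (use that in \<open>auto simp: npg_verts_def\<close>)
    show "{x, y} \<in> npg_edges G H"
    proof (cases "x = \<one> \<or> y = \<one>")
      case True
      then show ?thesis
        using one[of x] one[of y] xy that(1) by (auto simp: insert_commute)
    qed (use that(3) xy in blast)
  qed
  have same: "{y, z} \<in> npg_edges G H"
    if "x \<in> carrier G" "x \<notin> H" "y \<in> H #> x" "z \<in> H #> x" "y \<noteq> z" for x y z
  proof (rule npg_edgeI)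
    have "y \<in> carrier G" "z \<in> carrier G"
      using that r_coset_subset_G[of H x] subset by auto
    then show "H #> y = H #> (z [^] (1 :: nat))"
      using that coset_mem_iff by simp
  qed (use that coset_subset_npg_verts in auto)
  have "card H < 4"
  proof (rule ccontr)
    assume "\<not> card H < 4"
    obtain x where x: "x \<in> carrier G" "x \<notin> H"
      using assms(3) subset by blast
    have "finite (H #> x)"
      using r_coset_subset_G[of H x] x subset fin finite_subset by blast
    then have "card (insert \<one> (H #> x)) \<ge> 5"
      using coset_subset_npg_verts[OF x] card[OF x(1)] \<open>\<not> card H < 4\<close> by simp
    then show False
      using K5[of "insert \<one> (H #> x)"] coset_subset_npg_verts[OF x] same[OF x] by auto
  qed
  then show "card H \<in> {2, 3}"
    using two by auto
  show "x \<otimes> x \<in> H" if x: "x \<in> carrier G" for x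
  proof (rule ccontr)
    assume xx: "x \<otimes> x \<notin> H"
    have x': "inv x \<in> carrier G" "x \<notin> H" "inv x \<notin> H"
      using x xx subgroup.m_closed[OF is_subgroup] m_inv_closed[of "inv x"] by auto
    \<comment> \<open>Equality of the two cosets would put the square of \<open>x\<close> into
      \<open>H\<close>.\<close>
    have ne: "H #> x \<noteq> H #> inv x"
    proof
      assume "H #> x = H #> inv x"
      then have "H #> (x \<otimes> x) = H #> (inv x \<otimes> x)"
        using coset_mult[OF x x] coset_mult[OF x'(1) x] by metis
      then show False
        using xx x coset_eq_self_iff[of "x \<otimes> x"] coset_eq_self_iff[of \<one>] one_mem by simp
    qed
    let ?U = "insert \<one> ((H #> x) \<union> (H #> inv x))"
    have sub: "H #> x \<subseteq> carrier G" "H #> inv x \<subseteq> carrier G"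
      using r_coset_subset_G subset x x' by blast+
    have finc: "finite (H #> x)" "finite (H #> inv x)"
      using sub fin finite_subset by blast+
    have disj: "(H #> x) \<inter> (H #> inv x) = {}"
    proof (rule equals0I)
      fix y assume "y \<in> (H #> x) \<inter> (H #> inv x)"
      then have "H #> y = H #> x" "H #> y = H #> inv x"
        using coset_mem_iff[of x y] coset_mem_iff[of "inv x" y] sub x x'(1) by auto
      then show False
        using ne by simp
    qed
    \<comment> \<open>Two disjoint cosets of at least two elements each, and the identity outside
      both.\<close>
    then have "card ?U \<ge> 5"
      using finc card[OF x] card[OF x'(1)] two coset_subset_npg_verts(2)[OF x x'(2)]
        coset_subset_npg_verts(2)[OF x'(1,3)] by (simp add: card_Un_disjoint)
    have cross: "{z, y} \<in> npg_edges G H" if "y \<in> H #> x" "z \<in> H #> inv x" for y z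
    proof (rule npg_edgeI)
      have y: "y \<in> carrier G" "z \<in> carrier G"
        using that sub by blast+
      \<comment> \<open>The exponent \<open>order G - 1\<close> yields the inverse; it is positive
        because \<open>x\<close> is outside \<open>H\<close> and so differs from the
        identity.\<close>
      have "order G \<noteq> 1"
        using x x'(2) one_mem one_closed unfolding order_def by (metis card_1_singletonE singletonD)
      moreover have "order G > 0"
        using fin order_gt_0_iff_finite by blast
      ultimately show "order G - 1 > 0"
        by simp
      have "y \<otimes> y [^] (order G - 1) = \<one>"
        using y pow_order_eq_1[of y] \<open>order G > 0\<close> nat_pow_Suc2[of y "order G - 1"] by simp
      then have "y [^] (order G - 1) = inv y"
        using y by (metis inv_equality inv_inv inv_closed nat_pow_closed)
      moreover have "H #> inv y = H #> inv x"
        using that(1) coset_mem_iff[OF x y(1)] rcos_inv[OF x] rcos_inv[OF y(1)] by metis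
      ultimately show "H #> z = H #> (y [^] (order G - 1))"
        using that(2) coset_mem_iff[OF x'(1) y(2)] by simp
      show "z \<noteq> y"
        using that disj by blast
    qed (use that coset_subset_npg_verts x x' in auto)
    have "{y, z} \<in> npg_edges G H" if "y \<in> ?U" "z \<in> ?U" "y \<noteq> z" "y \<noteq> \<one>" "z \<noteq> \<one>" for y z
      using that same[OF x x'(2)] same[OF x'(1,3)] cross cross[unfolded insert_commute[of _ _ "{}"]] by auto
    then show False
      using K5[of ?U] \<open>card ?U \<ge> 5\<close> coset_subset_npg_verts[OF x x'(2)]
        coset_subset_npg_verts[OF x'(1,3)] by auto
  qed
qed

section \<open>Sufficiency: the power graph as part of a windmill\<close>

lemma coset_pow_cases:
  assumes exp: "\<And>x. x \<in> carrier G \<Longrightarrow> x \<otimes> x \<in> H" and y: "y \<in> carrier G"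
  shows "H #> (y [^] (m :: nat)) \<in> {H, H #> y}"
proof (induction m)
  case 0
  then show ?case
    using coset_eq_self_iff[of \<one>] one_mem by simp
next
  case (Suc m)
  have "H #> (y [^] Suc m) = (H #> (y [^] m)) <#> (H #> y)"
    using y coset_mult by simp
  moreover have "H <#> (H #> y) = H #> y"
    using y coset_mult[of \<one> y] coset_eq_self_iff[of \<one>] one_mem by simp
  moreover have "(H #> y) <#> (H #> y) = H"
    using y coset_mult[of y y] coset_eq_self_iff[of "y \<otimes> y"] exp by simp
  ultimately show ?case
    using Suc by auto
qed

text \<open>A power of \<open>y\<close> lies in \<open>H\<close> or in the coset of
  \<open>y\<close>, and the only vertex in \<open>H\<close> is the identity.\<close>

lemma npg_edge_cases:
  assumes exp: "\<And>x. x \<in> carrier G \<Longrightarrow> x \<otimes> x \<in> H" and e: "e \<in> npg_edges G H"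
  obtains x y where "e = {x, y}" "x \<in> npg_verts G H" "y \<in> npg_verts G H" "x \<noteq> y"
    "x = \<one> \<or> y = \<one> \<or> H #> x = H #> y"
proof -
  obtain x y m where xy: "e = {x, y}" "x \<in> npg_verts G H" "y \<in> npg_verts G H" "x \<noteq> y"
    "H #> x = H #> (y [^] (m :: nat))"
    using npg_edgeD[OF e] by metis
  have "y \<in> carrier G" "x \<in> carrier G" "x = \<one> \<or> x \<notin> H"
    using xy by (auto simp: npg_verts_def)
  then have "x = \<one> \<or> H #> x = H #> y"
    using xy(5) coset_pow_cases[OF exp, of y m] coset_eq_self_iff[of x] by auto
  then show thesis
    using that xy by blast
qed

lemma planar_npg:
  assumes fin: "finite (carrier G)" and card: "card H \<in> {2, 3}"
    and exp: "\<And>x. x \<in> carrier G \<Longrightarrow> x \<otimes> x \<in> H"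
  shows "planar_graph (npg_verts G H) (npg_edges G H)"
proof -
  have sub: "H #> x \<subseteq> carrier G" if "x \<in> carrier G" for x
    using r_coset_subset_G subset that by blast
  have "finite (rcosets H)"
    using fin by (simp add: RCOSETS_def)
  then obtain c :: "'a set \<Rightarrow> nat" where c: "inj_on c (rcosets H)"
    using finite_imp_inj_to_nat_seg by metis
  have "\<exists>i. inj_on i C \<and> i ` C \<subseteq> {0, 1, 2 :: nat}" if "C \<in> rcosets H" for C
  proof -
    have "card C \<le> 3"
      using card_rcosets_equal[OF that subset] card by auto
    have "C \<subseteq> carrier G"
      using that sub by (auto simp: RCOSETS_def)
    then have "finite C"
      using fin finite_subset by blast
    then obtain i :: "'a \<Rightarrow> nat" where "inj_on i C" "i ` C = {i. i < card C}"
      using finite_imp_inj_to_nat_seg[of C] by (metis card_Collect_less_nat card_image)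
    then show ?thesis
      using \<open>card C \<le> 3\<close> by (intro exI[of _ i]) auto
  qed
  then obtain i where i: "\<And>C. C \<in> rcosets H \<Longrightarrow> inj_on (i C) C \<and> i C ` C \<subseteq> {0, 1, 2 :: nat}"
    by metis
  \<comment> \<open>The identity goes to the hub; \<open>c\<close> numbers the cosets and so selects
    the copy, and \<open>i\<close> numbers the at most three elements of each coset.\<close>
  define f where "f x = (if x = \<one> then None else Some (c (H #> x), i (H #> x) x))" for x
  have carrier: "x \<in> carrier G" if "x \<in> npg_verts G H" for x
    using that by (auto simp: npg_verts_def)
  have coset: "H #> x \<in> rcosets H" "x \<in> H #> x" if "x \<in> npg_verts G H" for x
    using carrier[OF that] rcosetsI[OF subset] rcos_self is_subgroup by auto
  have rng: "i (H #> x) x \<in> {0, 1, 2}" if "x \<in> npg_verts G H" for x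
    using i[OF coset(1)[OF that]] coset(2)[OF that] by blast
  have inj: "inj_on f (npg_verts G H)"
  proof (rule inj_onI)
    fix x y assume xy: "x \<in> npg_verts G H" "y \<in> npg_verts G H" "f x = f y"
    show "x = y"
    proof (cases "x = \<one> \<or> y = \<one>")
      case True
      then show ?thesis
        using xy by (auto simp: f_def split: if_splits)
    next
      case False
      then have "c (H #> x) = c (H #> y)" "i (H #> x) x = i (H #> y) y"
        using xy by (auto simp: f_def)
      moreover then have "H #> x = H #> y"
        using c coset(1) xy by (meson inj_onD)
      ultimately show ?thesis
        using i[OF coset(1)[OF xy(1)]] coset(2)[OF xy(1)] coset(2)[OF xy(2)] by (auto dest: inj_onD)
    qed
  qed
  show ?thesis
  proof (rule planar_graph_embed[OF planar_windmill inj])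
    show "f ` npg_verts G H \<subseteq> windmill_verts"
      using rng by (auto simp: f_def windmill_verts_def)
  next
    fix e assume "e \<in> npg_edges G H"
    then obtain x y where xy: "e = {x, y}" "x \<in> npg_verts G H" "y \<in> npg_verts G H" "x \<noteq> y"
      "x = \<one> \<or> y = \<one> \<or> H #> x = H #> y"
      using npg_edge_cases[OF exp] by metis
    have block: "{u, v} \<in> windmill_block j"
      if "u \<noteq> v" "u \<in> insert None (Some ` ({j} \<times> {0, 1, 2}))" "v \<in> insert None (Some ` ({j} \<times> {0, 1, 2}))" for u v j
      using that by (auto simp: windmill_block_def doubleton_eq_iff)
    have "f x \<noteq> f y"
      using inj xy by (auto dest: inj_onD)
    \<comment> \<open>The copy is that of an end other than the identity; if neither end is the
      identity, both lie in one coset.\<close>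
    moreover obtain j where "f x \<in> insert None (Some ` ({j} \<times> {0, 1, 2}))" "f y \<in> insert None (Some ` ({j} \<times> {0, 1, 2}))"
    proof (cases "x = \<one>")
      case True
      then show thesis
        using that[of "c (H #> y)"] rng[OF xy(3)] by (auto simp: f_def)
    next
      case False
      then show thesis
        using that[of "c (H #> x)"] rng[OF xy(3)] rng[OF xy(2)] xy(5) by (auto simp: f_def)
    qed
    ultimately have "{f x, f y} \<in> windmill_block j"
      by (rule block)
    then show "e \<subseteq> npg_verts G H \<and> f ` e \<in> (\<Union>j. windmill_block j)"
      using xy by auto
  qed
qed

lemma Mod_square_one_iff:
  "(\<forall>C\<in>carrier (G Mod H). C \<otimes>\<^bsub>G Mod H\<^esub> C = \<one>\<^bsub>G Mod H\<^esub>) \<longleftrightarrow> (\<forall>x\<in>carrier G. x \<otimes> x \<in> H)"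
proof -
  have "(H #> x) <#> (H #> x) = H \<longleftrightarrow> x \<otimes> x \<in> H" if "x \<in> carrier G" for x
    using that coset_mult[of x x] coset_eq_self_iff[of "x \<otimes> x"] by simp
  then show ?thesis
    by (auto simp: FactGroup_def RCOSETS_def)
qed

end

theorem theorem5p4:
  fixes G :: "('a, 'b) monoid_scheme" and H :: "'a set"
  assumes "group G" and "finite (carrier G)"
    and "H \<lhd> G" and "H \<noteq> {\<one>\<^bsub>G\<^esub>}" and "H \<noteq> carrier G"
  shows "planar_graph (npg_verts G H) (npg_edges G H) \<longleftrightarrow>
    card H \<in> {2, 3} \<and>
    (\<exists>k::nat. k \<ge> 1 \<and> G Mod H \<cong> product_group {..<k} (\<lambda>_. integer_mod_group 2))"
proof -
  interpret normal H G by fact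
  interpret Q: group "G Mod H"
    by (rule factorgroup_is_group)
  have "finite (carrier (G Mod H))"
    using assms(2) by (simp add: FactGroup_def RCOSETS_def)
  then have "(\<exists>k::nat. G Mod H \<cong> product_group {..<k} (\<lambda>_. integer_mod_group 2)) \<longleftrightarrow>
      (\<forall>x\<in>carrier G. x \<otimes>\<^bsub>G\<^esub> x \<in> H)"
    using Q.exponent_2_iff_iso_product Mod_square_one_iff by blast
  \<comment> \<open>An empty product would make the quotient trivial, contrary to \<open>H\<close>
    being proper.\<close>
  moreover have "k \<ge> 1" if iso: "G Mod H \<cong> product_group {..<k} (\<lambda>_. integer_mod_group 2)" for k :: nat
  proof (rule ccontr)
    assume "\<not> k \<ge> 1"
    then have "k = 0"
      by simp
    then have "card (carrier (G Mod H)) = 1"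
      using iso_same_card[OF iso] by simp
    moreover obtain x where x: "x \<in> carrier G" "x \<notin> H"
      using assms(5) subset by blast
    then have "H #>\<^bsub>G\<^esub> x \<noteq> H" "H #>\<^bsub>G\<^esub> x \<in> carrier (G Mod H)" "H \<in> carrier (G Mod H)"
      using coset_eq_self_iff rcosetsI[OF subset] subgroup_in_rcosets[OF is_group] by (auto simp: FactGroup_def)
    ultimately show False
      by (auto simp: card_1_singleton_iff)
  qed
  ultimately show ?thesis
    using planar_npg_imp[OF assms(2,4,5)] planar_npg[OF assms(2)] by blast
qed

end
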